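(* For every $k\ge1$ and every choice of positive integers $a_1,\dots,a_k$ there is a simple graph $Z_{a_1,\dots,a_k}$, namely the one constructed in the context, such that, as formal power series in $q$, $$H_{Z_{a_1,\dots,a_k}}(q)=\frac{q^{-1}\,\mathfrak z_q^*(a_1,\dots,a_k)}{(q)_\infty^{\,k+a_1+\cdots+a_k}}.$$ In particular, for $k=1$ and $a_1=r$ this recovers $H_{T_{2r+2}}(q)=q^{-1}\mathfrak z_q^*(r)/(q)_\infty^{r+1}$.
   Context: Notation: $(q)_n=\prod_{j=1}^n(1-q^j)$, $(q)_\infty=\prod_{j\ge1}(1-q^j)$. Graph series: for a finite simple graph $\Gamma$ with vertices $1,\dots,r$ and adjacency matrix $A_\Gamma$, $$H_\Gamma(q)=\sum_{\mathbf n\in\mathbb Z_{\ge0}^r}\frac{q^{\frac12\mathbf n A_\Gamma\mathbf n^{\mathsf T}+n_1+\cdots+n_r}}{(q)_{n_1}\cdots(q)_{n_r}}.$$ Non-strict multiple $q$-zeta values: $$\mathfrak z_q^*(a_1,\dots,a_k)=\sum_{n_1\ge n_2\ge\cdots\ge n_k\ge1}\frac{q^{n_1}}{(1-q^{n_1})^{a_1}\cdots(1-q^{n_k})^{a_k}}.$$ The graph $Z_{a_1,\dots,a_k}$: start with vertices $1,\dots,k,1',\dots,k'$ and edges $i\sim i'$ for $1\le i\le k$. For each $i\in\{1,\dots,k\}$ and each $c\in\{1,\dots,a_i\}$ add two new vertices $u_{i,c}$ and $w_{i,c}$, with edges $u_{i,c}\sim w_{i,c}$ and $u_{i,c}\sim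 j$ for all $1\le j\le k+1-i$. There are no other vertices or edges. The graph $T_{2r+2}$ is the star-shaped tree with vertices $1,\dots,2r+2$ and edges $1\sim 2j$, $2j\sim 2j+1$ for $1\le j\le r$, and $1\sim 2r+2$. *)

theory Defs
  imports
    "HOL-Analysis.Infinite_Sum"
    "HOL-Analysis.Infinite_Products"
    "HOL-Computational_Algebra.Formal_Laurent_Series"
    "Graph_Theory.Pair_Digraph"
begin

text \<open>
  Finite simple graphs are rendered by the locale \<^locale>\<open>pair_graph\<close>: finite, loop-free,
  symmetric sets of arcs. An undirected edge is a pair of opposite arcs. The indeterminate
  \<open>q\<close> is \<^term>\<open>fps_X :: rat fps\<close>; infinite sums and products are taken in the
  \<open>X\<close>-adic topology of \<^typ>\<open>rat fps\<close>.
\<close>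

definition undirected :: "'v set \<Rightarrow> 'v rel \<Rightarrow> 'v pair_pre_digraph" where
  "undirected V E = \<lparr>pverts = V, parcs = E \<union> E\<inverse>\<rparr>"

definition adjacency :: "'v pair_pre_digraph \<Rightarrow> 'v \<Rightarrow> 'v \<Rightarrow> nat" where
  "adjacency G u v = of_bool ((u, v) \<in> parcs G)"

definition q_fact :: "nat \<Rightarrow> rat fps" where
  "q_fact n = (\<Prod>j = 1..n. 1 - fps_X ^ j)"

definition q_inf :: "rat fps" where
  "q_inf = (\<Prod>j. 1 - fps_X ^ Suc j)"

text \<open>
  The division by 2 in the exponent is exact, see \<open>even_adjacency_form\<close> below. Vectors are
  indexed by the vertex set itself, which need not be an initial segment of the integers.
\<close>

definition graph_term :: "'v pair_pre_digraph \<Rightarrow> ('v \<Rightarrow> nat) \<Rightarrow> rat fps" where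
  "graph_term G n =
     fps_X ^ ((\<Sum>u\<in>pverts G. \<Sum>v\<in>pverts G. n u * adjacency G u v * n v) div 2
              + (\<Sum>v\<in>pverts G. n v))
     / (\<Prod>v\<in>pverts G. q_fact (n v))"

definition graph_series :: "'v pair_pre_digraph \<Rightarrow> rat fps" where
  "graph_series G = infsum (graph_term G) (pverts G \<rightarrow>\<^sub>E UNIV)"

text \<open>
  Tuples \<open>(a\<^sub>1, \<dots>, a\<^sub>k)\<close> are functions of which only the values on \<open>{1..k}\<close> matter.
\<close>

definition qzeta_star :: "nat \<Rightarrow> (nat \<Rightarrow> nat) \<Rightarrow> rat fps" where
  "qzeta_star k a =
     (\<Sum>\<^sub>\<infinity>n\<in>{n \<in> {1..k} \<rightarrow>\<^sub>E UNIV. (\<forall>i\<in>{1..<k}. n i \<ge> n (Suc i)) \<and> n k \<ge> 1}.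
        fps_X ^ n 1 / (\<Prod>i = 1..k. (1 - fps_X ^ n i) ^ a i))"

datatype z_vertex = Vertex nat | Primed nat | U nat nat | W nat nat

definition Z_verts :: "nat \<Rightarrow> (nat \<Rightarrow> nat) \<Rightarrow> z_vertex set" where
  "Z_verts k a = Vertex ` {1..k} \<union> Primed ` {1..k}
     \<union> {U i c |i c. i \<in> {1..k} \<and> c \<in> {1..a i}}
     \<union> {W i c |i c. i \<in> {1..k} \<and> c \<in> {1..a i}}"

definition Z_edges :: "nat \<Rightarrow> (nat \<Rightarrow> nat) \<Rightarrow> z_vertex rel" where
  "Z_edges k a = {(Vertex i, Primed i) |i. i \<in> {1..k}}
     \<union> {(U i c, W i c) |i c. i \<in> {1..k} \<and> c \<in> {1..a i}}
     \<union> {(U i c, Vertex j) |i c j. i \<in> {1..k} \<and> c \<in> {1..a i} \<and> j \<in> {1..k + 1 - i}}"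

definition Z_graph :: "nat \<Rightarrow> (nat \<Rightarrow> nat) \<Rightarrow> z_vertex pair_pre_digraph" where
  "Z_graph k a = undirected (Z_verts k a) (Z_edges k a)"

text \<open>\<open>T_graph r\<close> is the tree \<open>T\<^bsub>2r+2\<^esub>\<close>.\<close>

definition T_graph :: "nat \<Rightarrow> nat pair_pre_digraph" where
  "T_graph r = undirected {1..2 * r + 2}
     ({(1, 2 * j) |j. j \<in> {1..r}} \<union> {(2 * j, 2 * j + 1) |j. j \<in> {1..r}} \<union> {(1, 2 * r + 2)})"


text \<open>
  The remaining facts show that the definitions are meaningful: the halved form is even, and all
  infinite sums and products converge.
\<close>

lemma even_symmetric_form:
  fixes f :: "'v \<Rightarrow> 'v \<Rightarrow> nat"
  assumes "finite V" "\<And>u v. f u v = f v u" "\<And>u. f u u = 0"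
  shows "even (\<Sum>u\<in>V. \<Sum>v\<in>V. f u v)"
  using assms(1)
proof (induction V rule: finite_induct)
  case (insert x V)
  have sym: "(\<Sum>u\<in>V. f u x) = (\<Sum>v\<in>V. f x v)"
    by (rule sum.cong[OF refl assms(2)])
  have "(\<Sum>u\<in>insert x V. \<Sum>v\<in>insert x V. f u v)
      = f x x + (\<Sum>v\<in>V. f x v) + (\<Sum>u\<in>V. f u x + (\<Sum>v\<in>V. f u v))"
    using insert.hyps by simp
  also have "\<dots> = 2 * (\<Sum>v\<in>V. f x v) + (\<Sum>u\<in>V. \<Sum>v\<in>V. f u v)"
    by (simp add: sum.distrib sym assms(3))
  finally show ?case using insert.IH by simp
qed simp

lemma even_adjacency_form:
  assumes "pair_graph G"
  shows "even (\<Sum>u\<in>pverts G. \<Sum>v\<in>pverts G. n u * adjacency G u v * n v)"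
proof (rule even_symmetric_form)
  interpret pair_graph G by fact
  show "finite (pverts G)" by (rule pair_finite_verts)
  have "sym (parcs G)"
    using pair_sym_arcs by (simp add: symmetric_def)
  then show "n u * adjacency G u v * n v = n v * adjacency G v u * n u" for u v
    by (auto simp: adjacency_def sym_def)
  show "n u * adjacency G u u * n u = 0" for u
    using pair_no_loops[of "(u, u)"] by (auto simp: adjacency_def)
qed

lemma pair_graph_undirected:
  assumes "finite V" "E \<subseteq> V \<times> V" "\<And>u. (u, u) \<notin> E"
  shows "pair_graph (undirected V E)"
proof
  show "finite (parcs (undirected V E))"
    using assms finite_subset[of E "V \<times> V"] by (auto simp: undirected_def)
  show "symmetric (with_proj (undirected V E))"
    by (auto simp: symmetric_def undirected_def sym_def)
qed (use assms in \<open>auto simp: undirected_def\<close>)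

lemma pair_graph_Z: "pair_graph (Z_graph k a)"
  unfolding Z_graph_def
proof (rule pair_graph_undirected)
  have "finite {U i c |i c. i \<in> {1..k} \<and> c \<in> {1..a i}}"
    by (rule finite_subset[of _ "case_prod U ` (SIGMA i:{1..k}. {1..a i})"]) auto
  moreover have "finite {W i c |i c. i \<in> {1..k} \<and> c \<in> {1..a i}}"
    by (rule finite_subset[of _ "case_prod W ` (SIGMA i:{1..k}. {1..a i})"]) auto
  ultimately show "finite (Z_verts k a)"
    by (simp add: Z_verts_def)
qed (auto simp: Z_verts_def Z_edges_def)

lemma pair_graph_T: "r \<ge> 1 \<Longrightarrow> pair_graph (T_graph r)"
  unfolding T_graph_def by (rule pair_graph_undirected) auto

lemma summable_on_fps_of_order:
  fixes F :: "'b \<Rightarrow> 'a::ab_group_add fps"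
  assumes "\<And>x m. x \<in> A \<Longrightarrow> m < d x \<Longrightarrow> fps_nth (F x) m = 0"
    and "\<And>m. finite {x \<in> A. d x \<le> m}"
  shows "F summable_on A"
proof -
  have "finite {x \<in> A. fps_nth (F x) m \<noteq> 0}" for m
    by (rule finite_subset[OF _ assms(2)[of m]]) (use assms(1) not_less in blast)
  then have "(F has_sum Abs_fps (\<lambda>m. \<Sum>x | x \<in> A \<and> fps_nth (F x) m \<noteq> 0. fps_nth (F x) m)) A"
    by (intro has_sum_fpsI) simp_all
  then show ?thesis by (auto simp: summable_on_def)
qed

lemma fps_nth_X_power_divide_eq_0:
  fixes P :: "rat fps"
  assumes "fps_nth P 0 = 1" "m < e"
  shows "fps_nth (fps_X ^ e / P) m = 0"
  using assms by (simp add: fps_divide_unit fps_X_power_mult_nth)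

lemma fps_nth_prod_0:
  fixes f :: "'b \<Rightarrow> 'a::comm_ring_1 fps"
  shows "fps_nth (prod f A) 0 = (\<Prod>x\<in>A. fps_nth (f x) 0)"
  by (induction A rule: infinite_finite_induct) simp_all

lemma q_fact_nth_0 [simp]: "fps_nth (q_fact n) 0 = 1"
  unfolding q_fact_def fps_nth_prod_0
  by (intro prod.neutral ballI) (simp add: fps_power_zeroth)

lemma summable_graph_term:
  assumes "finite (pverts G)"
  shows "graph_term G summable_on (pverts G \<rightarrow>\<^sub>E UNIV)"
proof (rule summable_on_fps_of_order)
  show "fps_nth (graph_term G n) m = 0" if "m < (\<Sum>v\<in>pverts G. n v)" for n m
    unfolding graph_term_def using that
    by (intro fps_nth_X_power_divide_eq_0) (simp_all add: fps_nth_prod_0)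
  show "finite {n \<in> pverts G \<rightarrow>\<^sub>E UNIV. (\<Sum>v\<in>pverts G. n v) \<le> m}" for m :: nat
  proof (rule finite_subset)
    show "{n \<in> pverts G \<rightarrow>\<^sub>E UNIV. (\<Sum>v\<in>pverts G. n v) \<le> m} \<subseteq> pverts G \<rightarrow>\<^sub>E {..m}"
    proof
      fix n assume n: "n \<in> {n \<in> pverts G \<rightarrow>\<^sub>E UNIV. (\<Sum>v\<in>pverts G. n v) \<le> m}"
      then have "n v \<le> m" if "v \<in> pverts G" for v
        using member_le_sum[OF that, of n] assms by simp
      with n show "n \<in> pverts G \<rightarrow>\<^sub>E {..m}" by (simp add: PiE_iff)
    qed
  qed (simp add: assms finite_PiE)
qed

lemma summable_qzeta_star:
  assumes "k \<ge> 1"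
  shows "(\<lambda>n. fps_X ^ n 1 / (\<Prod>i = 1..k. (1 - fps_X ^ n i) ^ a i) :: rat fps) summable_on
           {n \<in> {1..k} \<rightarrow>\<^sub>E UNIV. (\<forall>i\<in>{1..<k}. n i \<ge> n (Suc i)) \<and> n k \<ge> 1}"
    (is "_ summable_on ?A")
proof (rule summable_on_fps_of_order)
  have anti: "n j \<le> n i" if "n \<in> ?A" "1 \<le> i" "i \<le> j" "j \<le> k" for n :: "nat \<Rightarrow> nat" and i j
    using that(3,4)
  proof (induction j rule: dec_induct)
    case (step j)
    then have "n (Suc j) \<le> n j" using that(1,2) by auto
    with step show ?case by simp
  qed simp
  show "fps_nth (fps_X ^ n 1 / (\<Prod>i = 1..k. (1 - fps_X ^ n i) ^ a i) :: rat fps) m = 0"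
    if "n \<in> ?A" "m < n 1" for n m
  proof (rule fps_nth_X_power_divide_eq_0[OF _ that(2)])
    have "n i \<noteq> 0" if "i \<in> {1..k}" for i
      using anti[OF \<open>n \<in> ?A\<close>, of i k] that \<open>n \<in> ?A\<close> by auto
    then show "fps_nth (\<Prod>i = 1..k. (1 - fps_X ^ n i :: rat fps) ^ a i) 0 = 1"
      unfolding fps_nth_prod_0
      by (intro prod.neutral ballI) (simp add: fps_power_zeroth power_0_left)
  qed
  show "finite {n \<in> ?A. n 1 \<le> m}" for m
  proof (rule finite_subset)
    show "{n \<in> ?A. n 1 \<le> m} \<subseteq> {1..k} \<rightarrow>\<^sub>E {..m}"
    proof
      fix n assume n: "n \<in> {n \<in> ?A. n 1 \<le> m}"
      then have "n i \<le> m" if "i \<in> {1..k}" for i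
        using anti[of n 1 i] that by auto
      with n show "n \<in> {1..k} \<rightarrow>\<^sub>E {..m}" by (simp add: PiE_iff)
    qed
  qed (simp add: finite_PiE)
qed

lemma has_prod_q_inf: "(\<lambda>j. 1 - fps_X ^ Suc j) has_prod q_inf"
proof -
  define p :: "nat \<Rightarrow> rat fps" where "p n = (\<Prod>j\<le>n. 1 - fps_X ^ Suc j)" for n
  have stable: "fps_nth (p n) m = fps_nth (p m) m" if "m \<le> n" for m n
    using that
  proof (induction n rule: dec_induct)
    case (step n)
    have "p (Suc n) = p n - fps_X ^ Suc (Suc n) * p n"
      by (simp add: p_def algebra_simps)
    then have "fps_nth (p (Suc n)) m = fps_nth (p n) m"
      using step.hyps by (simp add: fps_X_power_mult_nth del: power_Suc)
    with step.IH show ?case by simp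
  qed simp
  have lim: "p \<longlonglongrightarrow> Abs_fps (\<lambda>m. fps_nth (p m) m)"
    by (rule tendsto_fpsI) (auto simp: eventually_sequentially intro: stable)
  have "fps_nth (p 0) 0 \<noteq> 0"
    by (simp add: p_def)
  then have "Abs_fps (\<lambda>m. fps_nth (p m) m) \<noteq> 0"
    by (metis fps_nth_Abs_fps fps_zero_nth)
  with lim have "(\<lambda>j. 1 - fps_X ^ Suc j) has_prod Abs_fps (\<lambda>m. fps_nth (p m) m)"
    by (auto simp: has_prod_def raw_has_prod_def p_def [abs_def])
  then show ?thesis
    unfolding q_inf_def by (metis has_prod_unique)
qed

end

theory Submission
  imports Defs "HOL-Analysis.Elementary_Metric_Spaces"
begin

text \<open>
  The vertices \<open>i'\<close> and \<open>w\<^sub>i\<^sub>,\<^sub>c\<close> are pendant, one attached to each of the remaining vertices. By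
  Euler's identity \<open>\<Sum>\<^sub>m q\<^bsup>m(n+1)\<^esup> / (q)\<^sub>m = (q)\<^sub>n / (q)\<^sub>\<infinity>\<close>, summing over the exponent \<open>m\<close> of a
  pendant vertex cancels the denominator \<open>(q)\<^sub>n\<close> of its neighbour at the price of a factor
  \<open>1 / (q)\<^sub>\<infinity>\<close>. What is left is a bipartite form without denominators, and the sums over the
  exponents of the \<open>u\<^sub>i\<^sub>,\<^sub>c\<close> are geometric, with value \<open>1 / (1 - q\<^bsup>N\<^esup>)\<close> for
  \<open>N = 1 + n\<^sub>1 + \<dots> + n\<^bsub>k+1-i\<^esub>\<close>. These partial sums range bijectively over the weakly decreasing
  sequences of positive integers, which gives the \<open>q\<close>-zeta value.
\<close>

section \<open>Continuity of addition and multiplication of power series\<close>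

instance fps :: (ab_group_add) topological_comm_monoid_add
proof
  fix a b :: "'a fps"
  show "LIM x (nhds a \<times>\<^sub>F nhds b). fst x + snd x :> nhds (a + b)"
  proof (rule tendsto_fpsI)
    fix n
    have "\<forall>\<^sub>F x in nhds a \<times>\<^sub>F nhds b. fps_nth (fst x) n = fps_nth a n"
      "\<forall>\<^sub>F x in nhds a \<times>\<^sub>F nhds b. fps_nth (snd x) n = fps_nth b n"
      using filterlim_fst filterlim_snd tendsto_fps_iff by blast+
    then show "\<forall>\<^sub>F x in nhds a \<times>\<^sub>F nhds b. fps_nth (fst x + snd x) n = fps_nth (a + b) n"
      by eventually_elim simp
  qed
qed

text \<open>Coefficient \<open>n\<close> of a product involves only the coefficients up to
  \<open>n\<close> of the two factors, and these finitely many are eventually constant. Continuity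
  of multiplication allows constant factors to be pulled out of infinite sums.\<close>

instance fps :: (comm_ring_1) topological_semigroup_mult
proof
  fix a b :: "'a fps"
  show "LIM x (nhds a \<times>\<^sub>F nhds b). fst x * snd x :> nhds (a * b)"
  proof (rule tendsto_fpsI)
    fix n
    have "\<forall>\<^sub>F x in nhds a \<times>\<^sub>F nhds b. fps_nth (fst x) i = fps_nth a i"
      "\<forall>\<^sub>F x in nhds a \<times>\<^sub>F nhds b. fps_nth (snd x) i = fps_nth b i" for i
      using filterlim_fst filterlim_snd tendsto_fps_iff by blast+
    then have "\<forall>\<^sub>F x in nhds a \<times>\<^sub>F nhds b. \<forall>i\<in>{0..n}.
        fps_nth (fst x) i = fps_nth a i \<and> fps_nth (snd x) i = fps_nth b i"
      by (intro eventually_ball_finite ballI eventually_conj) auto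
    then show "\<forall>\<^sub>F x in nhds a \<times>\<^sub>F nhds b. fps_nth (fst x * snd x) n = fps_nth (a * b) n"
      by eventually_elim (auto simp: fps_mult_nth intro!: sum.cong)
  qed
qed

section \<open>Summability from order bounds, and iterated sums over index functions\<close>

lemma fps_X_power_dvd_nth_eq_0:
  fixes f :: "'a::comm_ring_1 fps"
  assumes "fps_X ^ d dvd f" "m < d"
  shows "fps_nth f m = 0"
  using assms by (auto simp: dvd_def fps_X_power_mult_nth)

lemma finite_bounded_PiE:
  fixes m :: nat
  assumes "finite A"
  shows "finite {n \<in> A \<rightarrow>\<^sub>E UNIV. (\<Sum>v\<in>A. n v) \<le> m}"
proof (rule finite_subset)
  show "{n \<in> A \<rightarrow>\<^sub>E UNIV. (\<Sum>v\<in>A. n v) \<le> m} \<subseteq> A \<rightarrow>\<^sub>E {..m}"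
    using assms by (auto simp: PiE_iff extensional_def intro: order_trans[OF member_le_sum])
qed (simp add: assms finite_PiE)

text \<open>Only finitely many index functions have a given total or less, so each coefficient
  receives finitely many contributions. Order bounds are phrased as divisibility by a power of
  \<open>fps_X\<close>, which passes to products and covers the zero series.\<close>

lemma summable_on_fps_PiE:
  fixes F :: "('v \<Rightarrow> nat) \<Rightarrow> 'a::comm_ring_1 fps"
  assumes "finite A" "\<And>n. n \<in> A \<rightarrow>\<^sub>E UNIV \<Longrightarrow> fps_X ^ (\<Sum>v\<in>A. n v) dvd F n"
  shows "F summable_on (A \<rightarrow>\<^sub>E UNIV)"
proof (rule summable_on_fps_of_order[where d = "\<lambda>n. \<Sum>v\<in>A. n v"])
  show "fps_nth (F n) m = 0" if "n \<in> A \<rightarrow>\<^sub>E UNIV" "m < (\<Sum>v\<in>A. n v)" for n m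
    using fps_X_power_dvd_nth_eq_0[OF assms(2)] that by blast
qed (rule finite_bounded_PiE[OF assms(1)])

lemma summable_on_fps_nat:
  fixes f :: "nat \<Rightarrow> 'a::comm_ring_1 fps"
  assumes "\<And>m. fps_X ^ m dvd f m"
  shows "f summable_on A"
proof (rule summable_on_fps_of_order[where d = id])
  show "fps_nth (f x) m = 0" if "m < id x" for x m
    using fps_X_power_dvd_nth_eq_0[OF assms] that by simp
qed (simp add: finite_subset[of _ "{.._}"])

text \<open>Joins exponents on two disjoint vertex sets. Outside both sets the value comes from
  \<open>y\<close>, so extensionality is preserved.\<close>

definition glue :: "'v set \<Rightarrow> ('v \<Rightarrow> 'b) \<Rightarrow> ('v \<Rightarrow> 'b) \<Rightarrow> 'v \<Rightarrow> 'b" where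
  "glue A x y = (\<lambda>v. if v \<in> A then x v else y v)"

lemma glue_simps [simp]:
  "v \<in> A \<Longrightarrow> glue A x y v = x v" "v \<notin> A \<Longrightarrow> glue A x y v = y v"
  by (simp_all add: glue_def)

lemma bij_betw_glue:
  assumes "A \<inter> B = {}"
  shows "bij_betw (\<lambda>(x, y). glue A x y)
           ((A \<rightarrow>\<^sub>E UNIV) \<times> (B \<rightarrow>\<^sub>E UNIV)) (A \<union> B \<rightarrow>\<^sub>E UNIV)"
proof (rule bij_betwI[where g = "\<lambda>n. (restrict n A, restrict n B)"])
  show "(\<lambda>(x, y). glue A x y) \<in> (A \<rightarrow>\<^sub>E UNIV) \<times> (B \<rightarrow>\<^sub>E UNIV) \<rightarrow> (A \<union> B \<rightarrow>\<^sub>E UNIV)"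
    by (auto simp: glue_def PiE_iff extensional_def)
  show "(\<lambda>n. (restrict n A, restrict n B)) \<in> (A \<union> B \<rightarrow>\<^sub>E UNIV) \<rightarrow> (A \<rightarrow>\<^sub>E UNIV) \<times> (B \<rightarrow>\<^sub>E UNIV)"
    by auto
  fix p :: "('a \<Rightarrow> 'b) \<times> ('a \<Rightarrow> 'b)"
  assume "p \<in> (A \<rightarrow>\<^sub>E UNIV) \<times> (B \<rightarrow>\<^sub>E UNIV)"
  then show "(restrict ((\<lambda>(x, y). glue A x y) p) A, restrict ((\<lambda>(x, y). glue A x y) p) B) = p"
    using assms by (auto simp: glue_def fun_eq_iff PiE_iff extensional_def restrict_def split: prod.splits)
next
  fix n :: "'a \<Rightarrow> 'b"
  assume "n \<in> A \<union> B \<rightarrow>\<^sub>E UNIV"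
  then show "(\<lambda>(x, y). glue A x y) (restrict n A, restrict n B) = n"
    by (auto simp: glue_def fun_eq_iff PiE_iff extensional_def)
qed

text \<open>Fubini for exponent vectors. The order bound gives summability over the union; since the
  total over \<open>B\<close> is at most the total over \<open>A \<union> B\<close>, the same bound
  makes every inner sum converge.\<close>

lemma infsum_PiE_Un:
  fixes F :: "('v \<Rightarrow> nat) \<Rightarrow> 'a::comm_ring_1 fps"
  assumes "finite A" "finite B" "A \<inter> B = {}"
    and "\<And>n. n \<in> A \<union> B \<rightarrow>\<^sub>E UNIV \<Longrightarrow> fps_X ^ (\<Sum>v\<in>A \<union> B. n v) dvd F n"
  shows "infsum F (A \<union> B \<rightarrow>\<^sub>E UNIV)
       = infsum (\<lambda>x. infsum (\<lambda>y. F (glue A x y)) (B \<rightarrow>\<^sub>E UNIV)) (A \<rightarrow>\<^sub>E UNIV)"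
proof -
  have "F summable_on (A \<union> B \<rightarrow>\<^sub>E UNIV)"
    using assms by (intro summable_on_fps_PiE) auto
  then have "(F has_sum infsum F (A \<union> B \<rightarrow>\<^sub>E UNIV)) (A \<union> B \<rightarrow>\<^sub>E UNIV)"
    by (rule has_sum_infsum)
  then have sum: "((\<lambda>p. F (case p of (x, y) \<Rightarrow> glue A x y)) has_sum infsum F (A \<union> B \<rightarrow>\<^sub>E UNIV))
      ((A \<rightarrow>\<^sub>E UNIV) \<times> (B \<rightarrow>\<^sub>E UNIV))"
    by (subst has_sum_reindex_bij_betw[OF bij_betw_glue[OF assms(3)]])
  have "(\<lambda>y. F (glue A x y)) summable_on (B \<rightarrow>\<^sub>E UNIV)" if x: "x \<in> A \<rightarrow>\<^sub>E UNIV" for x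
  proof (rule summable_on_fps_PiE[OF assms(2)])
    fix y :: "'v \<Rightarrow> nat"
    assume "y \<in> B \<rightarrow>\<^sub>E UNIV"
    with x have "glue A x y \<in> A \<union> B \<rightarrow>\<^sub>E UNIV"
      using bij_betw_glue[OF assms(3)] by (auto simp: bij_betw_def)
    then have "fps_X ^ (\<Sum>v\<in>A \<union> B. glue A x y v) dvd F (glue A x y)"
      by (rule assms(4))
    moreover have "(\<Sum>v\<in>B. y v) = (\<Sum>v\<in>B. glue A x y v)"
      using assms(3) by (intro sum.cong) (auto simp: glue_def)
    then have "(\<Sum>v\<in>B. y v) \<le> (\<Sum>v\<in>A \<union> B. glue A x y v)"
      using assms by (simp add: sum.union_disjoint)
    ultimately show "fps_X ^ (\<Sum>v\<in>B. y v) dvd F (glue A x y)"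
      using le_imp_power_dvd dvd_trans by blast
  qed
  with sum have "((\<lambda>x. infsum (\<lambda>y. F (glue A x y)) (B \<rightarrow>\<^sub>E UNIV)) has_sum
      infsum F (A \<union> B \<rightarrow>\<^sub>E UNIV)) (A \<rightarrow>\<^sub>E UNIV)"
    by (intro has_sum_SigmaD[OF sum]) auto
  then show ?thesis
    by (simp add: infsumI)
qed

lemma infsum_prod_PiE_fps:
  fixes f :: "'v \<Rightarrow> nat \<Rightarrow> 'a::comm_ring_1 fps"
  assumes "finite A" "\<And>v m. v \<in> A \<Longrightarrow> fps_X ^ m dvd f v m"
  shows "infsum (\<lambda>n. \<Prod>v\<in>A. f v (n v)) (A \<rightarrow>\<^sub>E UNIV) = (\<Prod>v\<in>A. infsum (f v) UNIV)"
  using assms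
proof (induction A rule: finite_induct)
  case (insert a A)
  \<comment> \<open>Stated for every subset because it serves both \<open>A\<close> and
    \<open>insert a A\<close>.\<close>
  have dvd: "fps_X ^ (\<Sum>v\<in>B. n v) dvd (\<Prod>v\<in>B. f v (n v))" if "B \<subseteq> insert a A" for B and n :: "'v \<Rightarrow> nat"
    unfolding power_sum by (rule prod_dvd_prod) (use that insert.prems in blast)
  have sum_f: "f a summable_on UNIV"
    using insert.prems by (intro summable_on_fps_nat) auto
  have sum_A: "(\<lambda>n. \<Prod>v\<in>A. f v (n v)) summable_on (A \<rightarrow>\<^sub>E UNIV)"
    using insert.hyps by (intro summable_on_fps_PiE dvd) auto
  \<comment> \<open>Index functions on one point are numbers; this turns the outer sum into a sum
    over \<open>nat\<close>.\<close>
  have reindex: "bij_betw (\<lambda>m. \<lambda>v\<in>{a}. m) UNIV ({a} \<rightarrow>\<^sub>E (UNIV :: nat set))"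
    by (rule bij_betwI[where g = "\<lambda>n. n a"]) (auto simp: PiE_iff extensional_def fun_eq_iff)
  have "infsum (\<lambda>n. \<Prod>v\<in>insert a A. f v (n v)) ({a} \<union> A \<rightarrow>\<^sub>E UNIV)
      = infsum (\<lambda>x. infsum (\<lambda>y. \<Prod>v\<in>insert a A. f v (glue {a} x y v)) (A \<rightarrow>\<^sub>E UNIV))
          ({a} \<rightarrow>\<^sub>E UNIV)"
    using insert.hyps dvd[of "insert a A"] by (intro infsum_PiE_Un) auto
  also have "\<dots> = infsum (\<lambda>x. infsum (\<lambda>y. f a (x a) * (\<Prod>v\<in>A. f v (y v))) (A \<rightarrow>\<^sub>E UNIV))
          ({a} \<rightarrow>\<^sub>E UNIV)"
  proof (intro infsum_cong)
    fix x y :: "'v \<Rightarrow> nat"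
    have "(\<Prod>v\<in>A. f v (glue {a} x y v)) = (\<Prod>v\<in>A. f v (y v))"
      using insert.hyps by (intro prod.cong) (auto simp: glue_def)
    then show "(\<Prod>v\<in>insert a A. f v (glue {a} x y v)) = f a (x a) * (\<Prod>v\<in>A. f v (y v))"
      using insert.hyps by simp
  qed
  also have "\<dots> = infsum (\<lambda>x. f a (x a) * (\<Prod>v\<in>A. infsum (f v) UNIV)) ({a} \<rightarrow>\<^sub>E UNIV)"
    using insert.IH insert.prems by (simp add: infsum_cmult_right[OF sum_A])
  also have "\<dots> = infsum (\<lambda>m. f a m * (\<Prod>v\<in>A. infsum (f v) UNIV)) UNIV"
    by (subst infsum_reindex_bij_betw[OF reindex, symmetric]) simp
  also have "\<dots> = infsum (f a) UNIV * (\<Prod>v\<in>A. infsum (f v) UNIV)"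
    by (rule infsum_cmult_left[OF sum_f])
  finally show ?case
    using insert.hyps by simp
qed (simp add: PiE_empty_domain)

section \<open>Geometric series and Euler's identity\<close>

lemma infsum_geometric_fps:
  assumes "d \<ge> 1"
  shows "infsum (\<lambda>m. fps_X ^ (m * d)) UNIV = 1 / (1 - fps_X ^ d :: rat fps)"
proof -
  let ?S = "infsum (\<lambda>m. fps_X ^ (m * d) :: rat fps) UNIV"
  have "(\<lambda>m. fps_X ^ (m * d) :: rat fps) summable_on UNIV"
    using assms by (intro summable_on_fps_nat le_imp_power_dvd) simp
  then have S: "((\<lambda>m. fps_X ^ (m * d) :: rat fps) has_sum ?S) UNIV"
    by (rule has_sum_infsum)
  \<comment> \<open>The terms with positive index are \<open>fps_X ^ d\<close> times the whole
    series; adding the term at 0 yields \<open>?S = 1 + fps_X ^ d * ?S\<close>.\<close>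
  have "((\<lambda>m. fps_X ^ (m * d) :: rat fps) has_sum fps_X ^ d * ?S) (range Suc)"
    unfolding has_sum_reindex[OF inj_Suc] using has_sum_cmult_right[OF S, of "fps_X ^ d"]
    by (simp add: o_def power_add)
  then have "((\<lambda>m. fps_X ^ (m * d) :: rat fps) has_sum 1 + fps_X ^ d * ?S) (insert 0 (range Suc))"
    using has_sum_insert[of 0 "range Suc"] by fastforce
  then have "?S = 1 + fps_X ^ d * ?S"
    using S by (simp add: UNIV_nat_eq[symmetric] has_sum_unique)
  then have "1 = ?S * (1 - fps_X ^ d)"
    by (simp add: algebra_simps)
  \<comment> \<open>The identity just obtained already exhibits an inverse, which excludes
    0.\<close>
  moreover have "1 - fps_X ^ d \<noteq> (0 :: rat fps)"
    by (metis calculation mult_zero_right zero_neq_one)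
  ultimately show ?thesis
    by (metis nonzero_mult_div_cancel_right)
qed

lemma q_fact_Suc: "q_fact (Suc n) = q_fact n * (1 - fps_X ^ Suc n)"
  by (simp add: q_fact_def)

lemma q_fact_0 [simp]: "q_fact 0 = 1"
  by (simp add: q_fact_def)

lemma q_fact_tendsto: "q_fact \<longlonglongrightarrow> q_inf"
proof -
  have "q_fact n = (\<Prod>j<n. 1 - fps_X ^ Suc j)" for n
    by (induction n) (simp_all add: q_fact_Suc)
  then show ?thesis
    using has_prod_imp_tendsto'[OF has_prod_q_inf] by presburger
qed

text \<open>The term of Euler's series \<open>\<Sum> z^m / (q)_m\<close> at
  \<open>z = q^(n+1)\<close>. It is the contribution of a pendant vertex with exponent
  \<open>m\<close> whose neighbour has exponent \<open>n\<close>: the edge gives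
  \<open>m * n\<close>, the linear part gives \<open>m\<close>.\<close>

definition euler_term :: "nat \<Rightarrow> nat \<Rightarrow> rat fps" where
  "euler_term n m = fps_X ^ (m * Suc n) / q_fact m"

lemma dvd_euler_term: "fps_X ^ (m * Suc n) dvd euler_term n m"
  by (simp add: euler_term_def fps_divide_unit)

text \<open>This bound, uniform in \<open>n\<close>, has the shape the summability lemmas require;
  the sharper one serves to let \<open>n\<close> tend to infinity.\<close>

lemma dvd_euler_term': "fps_X ^ m dvd euler_term n m"
  by (rule dvd_trans[OF le_imp_power_dvd dvd_euler_term]) simp

lemma has_sum_euler_term: "(euler_term n has_sum infsum (euler_term n) UNIV) UNIV"
  by (intro has_sum_infsum summable_on_fps_nat dvd_euler_term')

text \<open>With \<open>a\<close> the numerator on the left, the two Euler numerators at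
  \<open>Suc m\<close> differ by \<open>a * (1 - q^(m+1))\<close>, and this factor cancels the last
  factor of \<open>q_fact (Suc m)\<close>. Summed over \<open>m\<close>, this becomes the recurrence
  in \<open>n\<close>.\<close>

lemma euler_term_Suc_diff:
  "euler_term n (Suc m) = euler_term (Suc n) (Suc m) + fps_X ^ Suc n * euler_term n m"
proof -
  define a b c :: "rat fps" where "a = fps_X ^ (Suc m * Suc n)" and "b = 1 - fps_X ^ Suc m"
    and "c = inverse (q_fact m)"
  have b: "b * inverse b = 1"
    by (simp add: b_def inverse_mult_eq_1')
  have inv: "inverse (q_fact (Suc m)) = c * inverse b"
    unfolding q_fact_Suc b_def c_def fps_inverse_mult by simp
  have "fps_X ^ (Suc m * Suc (Suc n)) = a * (1 - b)"
    by (simp add: a_def b_def power_add)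
  then have "euler_term (Suc n) (Suc m) = a * (1 - b) * (c * inverse b)"
    using inv by (simp add: euler_term_def fps_divide_unit del: power_Suc)
  also have "\<dots> = a * (c * inverse b) - a * c * (b * inverse b)"
    by (simp add: algebra_simps)
  also have "a * (c * inverse b) = euler_term n (Suc m)"
    using inv by (simp add: euler_term_def fps_divide_unit a_def del: power_Suc)
  also have "a * c * (b * inverse b) = fps_X ^ Suc n * euler_term n m"
    unfolding b by (simp add: a_def c_def euler_term_def fps_divide_unit power_add)
  finally show ?thesis
    by simp
qed

text \<open>
  The series \<open>S n\<close> satisfies \<open>(1 - q\<^bsup>n+1\<^esup>) S n = S (n+1)\<close>, so \<open>S n = (q)\<^sub>n S 0\<close>, and \<open>S n\<close>
  tends to 1.
\<close>

lemma infsum_euler_term: "infsum (euler_term n) UNIV * q_inf = q_fact n"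
proof -
  define S where "S n = infsum (euler_term n) UNIV" for n
  have S: "(euler_term n has_sum S n) UNIV" for n
    unfolding S_def by (rule has_sum_euler_term)
  have rec: "(1 - fps_X ^ Suc n) * S n = S (Suc n)" for n
  proof -
    \<comment> \<open>The last summand of \<open>euler_term_Suc_diff\<close>, moved up by one index.
      The value at 0 is 0 because both Euler terms there equal 1.\<close>
    define shifted where "shifted m = (if m = 0 then 0 else fps_X ^ Suc n * euler_term n (m - 1))" for m
    have "(shifted has_sum fps_X ^ Suc n * S n) (range Suc)"
      unfolding has_sum_reindex[OF inj_Suc] using has_sum_cmult_right[OF S, of "fps_X ^ Suc n"]
      by (simp add: o_def shifted_def del: power_Suc)
    then have "(shifted has_sum fps_X ^ Suc n * S n) UNIV"
      by (rule has_sum_cong_neutral[THEN iffD1, rotated -1])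
        (auto simp: shifted_def image_iff gr0_conv_Suc)
    then have "((\<lambda>m. euler_term (Suc n) m + shifted m) has_sum S (Suc n) + fps_X ^ Suc n * S n) UNIV"
      by (rule has_sum_add[OF S])
    moreover have "euler_term (Suc n) m + shifted m = euler_term n m" for m
      using euler_term_Suc_diff[of n "m - 1"]
      by (cases m) (simp_all add: euler_term_def shifted_def del: power_Suc)
    ultimately have "(euler_term n has_sum S (Suc n) + fps_X ^ Suc n * S n) UNIV"
      by (simp only:)
    then have "S n = S (Suc n) + fps_X ^ Suc n * S n"
      by (rule has_sum_unique[OF S])
    then show ?thesis
      by (simp add: algebra_simps)
  qed
  have S_eq: "S n = q_fact n * S 0" for n
  proof (induction n)
    case (Suc n)
    then show ?case
      using rec[of n] unfolding q_fact_Suc by (metis mult.assoc mult.commute)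
  qed simp
  \<comment> \<open>For \<open>n \<ge> j\<close>, a term with \<open>m \<noteq> 0\<close> has order
    at least \<open>n + 1 > j\<close>, so coefficient \<open>j\<close> sees only the term 1 at
    \<open>m = 0\<close>.\<close>
  have "S \<longlonglongrightarrow> 1"
  proof (rule tendsto_fpsI)
    fix j
    have "fps_nth (S n) j = fps_nth 1 j" if "n \<ge> j" for n
    proof -
      have "fps_nth (euler_term n m) j = 0" if "m \<noteq> 0" for m
        by (rule fps_X_power_dvd_nth_eq_0[OF dvd_euler_term]) (use that \<open>n \<ge> j\<close> in \<open>cases m; simp\<close>)
      moreover have "euler_term n 0 = 1"
        by (simp add: euler_term_def)
      ultimately have "fps_nth (euler_term n m) j \<noteq> 0 \<longleftrightarrow> m = 0 \<and> j = 0" for m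
        by (cases "m = 0") auto
      then show ?thesis
        using has_sum_fpsD(2)[OF S, of n j] \<open>euler_term n 0 = 1\<close> by (cases "j = 0") auto
    qed
    then show "\<forall>\<^sub>F n in sequentially. fps_nth (S n) j = fps_nth 1 j"
      unfolding eventually_sequentially by blast
  qed
  \<comment> \<open>A second evaluation of the limit of \<open>S\<close>; uniqueness of limits then
    determines \<open>S 0\<close>.\<close>
  moreover have "(\<lambda>n. q_fact n * S 0) \<longlonglongrightarrow> q_inf * S 0"
    by (rule tendsto_mult[OF q_fact_tendsto tendsto_const])
  then have "S \<longlonglongrightarrow> q_inf * S 0"
    by (simp only: S_eq[symmetric])
  ultimately have "q_inf * S 0 = 1"
    using LIMSEQ_unique by blast
  then have "S n * q_inf = q_fact n"
    unfolding S_eq[of n] by (simp only: mult.assoc mult.commute[of "S 0"] mult_1_right)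
  then show ?thesis
    by (simp only: S_def)
qed

section \<open>Graph series: pendant vertices, bipartite forms, isomorphisms\<close>

text \<open>Here \<open>E\<close> holds one orientation of each edge, so \<open>E\<close> and its
  converse are disjoint and contribute equally to the adjacency form. This cancels the division by
  2.\<close>

lemma graph_term_undirected:
  assumes "finite V" "E \<subseteq> V \<times> V" "\<And>u v. (u, v) \<in> E \<Longrightarrow> (v, u) \<notin> E"
  shows "graph_term (undirected V E) n
       = fps_X ^ ((\<Sum>(u, v)\<in>E. n u * n v) + (\<Sum>v\<in>V. n v)) / (\<Prod>v\<in>V. q_fact (n v))"
proof -
  have "finite E"
    using assms by (meson finite_SigmaI finite_subset)
  have "(\<Sum>u\<in>V. \<Sum>v\<in>V. n u * adjacency (undirected V E) u v * n v)
      = (\<Sum>(u, v)\<in>V \<times> V. n u * adjacency (undirected V E) u v * n v)"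
    by (rule sum.cartesian_product)
  also have "\<dots> = (\<Sum>(u, v)\<in>E \<union> E\<inverse>. n u * n v)"
    using assms by (intro sum.mono_neutral_cong_right) (auto simp: adjacency_def undirected_def)
  also have "\<dots> = (\<Sum>(u, v)\<in>E. n u * n v) + (\<Sum>(u, v)\<in>E\<inverse>. n u * n v)"
    using assms(3) \<open>finite E\<close> by (intro sum.union_disjoint) auto
  also have "(\<Sum>(u, v)\<in>E\<inverse>. n u * n v) = (\<Sum>(u, v)\<in>E. n u * n v)"
    by (rule sum.reindex_bij_witness[where i = prod.swap and j = prod.swap]) (auto simp: mult.commute)
  finally show ?thesis
    by (simp add: graph_term_def undirected_def)
qed

lemma fps_inverse_prod:
  fixes f :: "'b \<Rightarrow> 'a::field fps"
  shows "inverse (\<Prod>x\<in>A. f x) = (\<Prod>x\<in>A. inverse (f x))"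
  by (induction A rule: infinite_finite_induct) (simp_all add: fps_inverse_mult)

text \<open>One leaf hangs on every vertex of the core \<open>C\<close>. For fixed core exponents
  the sum over the leaves factors into Euler sums, each cancelling the denominator of its core
  vertex and leaving one factor \<open>1 / q_inf\<close>.\<close>

lemma graph_series_corona:
  assumes "finite C" "E \<subseteq> C \<times> C" "\<And>u v. (u, v) \<in> E \<Longrightarrow> (v, u) \<notin> E"
    and "inj_on leaf C" "C \<inter> leaf ` C = {}"
  shows "graph_series (undirected (C \<union> leaf ` C) (E \<union> (\<lambda>v. (v, leaf v)) ` C)) * q_inf ^ card C
       = infsum (\<lambda>n. fps_X ^ ((\<Sum>(u, v)\<in>E. n u * n v) + (\<Sum>v\<in>C. n v))) (C \<rightarrow>\<^sub>E UNIV)"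
proof -
  define G where "G = undirected (C \<union> leaf ` C) (E \<union> (\<lambda>v. (v, leaf v)) ` C)"
  define L where "L = leaf ` C"
  define t where "t n = (fps_X :: rat fps) ^ ((\<Sum>(u, v)\<in>E. n u * n v) + (\<Sum>v\<in>C. n v))" for n
  have finE: "finite E"
    using assms by (meson finite_SigmaI finite_subset)
  have [simp]: "leaf v \<notin> C" if "v \<in> C" for v
    using assms(5) that by auto
  have inv [simp]: "inv_into C leaf (leaf v) = v" if "v \<in> C" for v
    using assms(4) that by (rule inv_into_f_f)
  have G_term: "graph_term G n = fps_X ^ ((\<Sum>(u, v)\<in>E \<union> (\<lambda>v. (v, leaf v)) ` C. n u * n v)
      + (\<Sum>v\<in>C \<union> L. n v)) / (\<Prod>v\<in>C \<union> L. q_fact (n v))" for n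
    unfolding G_def L_def by (rule graph_term_undirected) (use assms in auto)
  \<comment> \<open>A leaf \<open>w\<close> meets only its core vertex
    \<open>inv_into C leaf w\<close>, so the term is a core factor times one Euler term per
    leaf.\<close>
  have term_glue: "graph_term G (glue C x y)
      = (t x * (\<Prod>v\<in>C. inverse (q_fact (x v)))) * (\<Prod>w\<in>L. euler_term (x (inv_into C leaf w)) (y w))" for x y
  proof -
    have "(\<Sum>(u, v)\<in>E. glue C x y u * glue C x y v) = (\<Sum>(u, v)\<in>E. x u * x v)"
      using assms(2) by (intro sum.cong) (auto simp: glue_def)
    moreover have "(\<Sum>(u, v)\<in>(\<lambda>v. (v, leaf v)) ` C. glue C x y u * glue C x y v)
        = (\<Sum>v\<in>C. x v * y (leaf v))"
      by (subst sum.reindex) (auto simp: inj_on_def intro!: sum.cong)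
    ultimately have "(\<Sum>(u, v)\<in>E \<union> (\<lambda>v. (v, leaf v)) ` C. glue C x y u * glue C x y v)
        = (\<Sum>(u, v)\<in>E. x u * x v) + (\<Sum>v\<in>C. x v * y (leaf v))"
      using assms finE by (subst sum.union_disjoint) auto
    moreover have "(\<Sum>v\<in>C \<union> L. glue C x y v) = (\<Sum>v\<in>C. x v) + (\<Sum>v\<in>C. y (leaf v))"
      using assms unfolding L_def
      by (subst sum.union_disjoint) (auto simp: sum.reindex intro!: sum.cong arg_cong2[of _ _ _ _ "(+)"])
    moreover have "(\<Prod>v\<in>C \<union> L. q_fact (glue C x y v)) = (\<Prod>v\<in>C. q_fact (x v)) * (\<Prod>v\<in>C. q_fact (y (leaf v)))"
      using assms unfolding L_def
      by (subst prod.union_disjoint) (auto simp: prod.reindex intro!: prod.cong arg_cong2[of _ _ _ _ "(*)"])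
    \<comment> \<open>The \<open>Suc\<close> merges the edge weight \<open>x v * y (leaf v)\<close>
      with the linear weight \<open>y (leaf v)\<close> of the leaf.\<close>
    ultimately have *: "graph_term G (glue C x y) = t x * fps_X ^ (\<Sum>v\<in>C. y (leaf v) * Suc (x v))
        * inverse ((\<Prod>v\<in>C. q_fact (x v)) * (\<Prod>v\<in>C. q_fact (y (leaf v))))"
      unfolding G_term
      by (subst fps_divide_unit) (simp_all add: t_def fps_nth_prod_0 power_add sum.distrib algebra_simps)
    have "(\<Prod>w\<in>L. euler_term (x (inv_into C leaf w)) (y w)) = (\<Prod>v\<in>C. euler_term (x v) (y (leaf v)))"
      unfolding L_def using assms(4) by (simp add: prod.reindex)
    also have "\<dots> = fps_X ^ (\<Sum>v\<in>C. y (leaf v) * Suc (x v)) * (\<Prod>v\<in>C. inverse (q_fact (y (leaf v))))"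
      by (simp add: euler_term_def fps_divide_unit prod.distrib power_sum del: mult_Suc_right)
    finally show ?thesis
      unfolding * by (simp add: fps_inverse_mult fps_inverse_prod mult_ac)
  qed
  \<comment> \<open>Euler's identity at \<open>n = 0\<close> shows that \<open>q_inf\<close> is a
    unit, so its constant coefficient is nonzero.\<close>
  have q_inf_inv: "q_inf * inverse q_inf = 1"
  proof -
    have "infsum (euler_term 0) UNIV * q_inf = 1"
      using infsum_euler_term[of 0] by simp
    then have "fps_nth q_inf 0 \<noteq> 0"
      by (metis fps_mult_nth_0 fps_one_nth mult_zero_right one_neq_zero)
    then show ?thesis
      by (rule inverse_mult_eq_1')
  qed
  have euler_eq: "infsum (euler_term n) UNIV = q_fact n * inverse q_inf" for n
    unfolding infsum_euler_term[symmetric] using q_inf_inv by (simp add: mult.assoc)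
  have sum_t: "t summable_on (C \<rightarrow>\<^sub>E UNIV)"
    using assms(1) unfolding t_def by (intro summable_on_fps_PiE le_imp_power_dvd) auto
  have "graph_series G = infsum (graph_term G) (C \<union> L \<rightarrow>\<^sub>E UNIV)"
    by (simp add: graph_series_def G_def undirected_def L_def)
  also have "\<dots> = infsum (\<lambda>x. infsum (\<lambda>y. graph_term G (glue C x y)) (L \<rightarrow>\<^sub>E UNIV)) (C \<rightarrow>\<^sub>E UNIV)"
  proof (rule infsum_PiE_Un)
    fix n
    show "fps_X ^ (\<Sum>v\<in>C \<union> L. n v) dvd graph_term G n"
      unfolding G_term by (subst fps_divide_unit) (simp_all add: fps_nth_prod_0 power_add dvd_mult2)
  qed (use assms in \<open>auto simp: L_def\<close>)
  also have "\<dots> = infsum (\<lambda>x. t x * inverse q_inf ^ card C) (C \<rightarrow>\<^sub>E UNIV)"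
  proof (rule infsum_cong)
    fix x
    have "infsum (\<lambda>y. \<Prod>w\<in>L. euler_term (x (inv_into C leaf w)) (y w)) (L \<rightarrow>\<^sub>E UNIV)
        = (\<Prod>w\<in>L. infsum (euler_term (x (inv_into C leaf w))) UNIV)"
      using assms(1) unfolding L_def by (intro infsum_prod_PiE_fps dvd_euler_term') auto
    also have "\<dots> = (\<Prod>v\<in>C. infsum (euler_term (x v)) UNIV)"
      unfolding L_def using assms(4) by (simp add: prod.reindex)
    also have "\<dots> = (\<Prod>v\<in>C. q_fact (x v) * inverse q_inf)"
      by (simp only: euler_eq)
    finally have L_sum: "infsum (\<lambda>y. \<Prod>w\<in>L. euler_term (x (inv_into C leaf w)) (y w)) (L \<rightarrow>\<^sub>E UNIV)
        = (\<Prod>v\<in>C. q_fact (x v)) * inverse q_inf ^ card C"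
      by (simp add: prod.distrib)
    have "(\<lambda>y. \<Prod>w\<in>L. euler_term (x (inv_into C leaf w)) (y w)) summable_on (L \<rightarrow>\<^sub>E UNIV)"
      using assms(1) unfolding L_def power_sum
      by (intro summable_on_fps_PiE, simp) (unfold power_sum, intro prod_dvd_prod dvd_euler_term')
    then have "infsum (\<lambda>y. graph_term G (glue C x y)) (L \<rightarrow>\<^sub>E UNIV)
        = t x * (\<Prod>v\<in>C. inverse (q_fact (x v))) * ((\<Prod>v\<in>C. q_fact (x v)) * inverse q_inf ^ card C)"
      unfolding term_glue L_sum[symmetric] by (rule infsum_cmult_right)
    also have "\<dots> = t x * (\<Prod>v\<in>C. inverse (q_fact (x v)) * q_fact (x v)) * inverse q_inf ^ card C"
      by (simp add: prod.distrib mult_ac)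
    also have "(\<Prod>v\<in>C. inverse (q_fact (x v)) * q_fact (x v)) = 1"
      by (simp add: inverse_mult_eq_1)
    finally show "infsum (\<lambda>y. graph_term G (glue C x y)) (L \<rightarrow>\<^sub>E UNIV) = t x * inverse q_inf ^ card C"
      by simp
  qed
  also have "\<dots> = infsum t (C \<rightarrow>\<^sub>E UNIV) * inverse q_inf ^ card C"
    by (rule infsum_cmult_left[OF sum_t])
  finally have "graph_series G * q_inf ^ card C = infsum t (C \<rightarrow>\<^sub>E UNIV) * (q_inf * inverse q_inf) ^ card C"
    by (simp add: power_mult_distrib mult_ac)
  then show ?thesis
    by (simp add: q_inf_inv G_def t_def[abs_def])
qed

text \<open>Once the exponents on \<open>A\<close> are fixed, the form is linear in those on
  \<open>B\<close>, and the sum over \<open>B\<close> splits into geometric series. The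
  \<open>Suc\<close> is the linear weight of \<open>u\<close> itself and keeps each ratio a positive
  power of \<open>fps_X\<close>.\<close>

lemma infsum_bipartite:
  assumes "finite A" "finite B" "A \<inter> B = {}" "E \<subseteq> B \<times> A"
  shows "infsum (\<lambda>n. fps_X ^ ((\<Sum>(u, v)\<in>E. n u * n v) + (\<Sum>v\<in>A \<union> B. n v)) :: rat fps) (A \<union> B \<rightarrow>\<^sub>E UNIV)
       = infsum (\<lambda>x. fps_X ^ (\<Sum>v\<in>A. x v) * (\<Prod>u\<in>B. 1 / (1 - fps_X ^ Suc (\<Sum>v\<in>E `` {u}. x v))))
           (A \<rightarrow>\<^sub>E UNIV)"
proof -
  \<comment> \<open>Grouping the edges by their endpoint in \<open>B\<close> exposes the coefficient
    of each \<open>y u\<close>.\<close>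
  have E_eq: "E = Sigma B (\<lambda>u. E `` {u})"
    using assms(4) by auto
  have fin: "finite (E `` {u})" for u
    using assms by (intro finite_subset[OF _ assms(1)]) auto
  let ?t = "\<lambda>n. fps_X ^ ((\<Sum>(u, v)\<in>E. n u * n v) + (\<Sum>v\<in>A \<union> B. n v)) :: rat fps"
  have "infsum ?t (A \<union> B \<rightarrow>\<^sub>E UNIV)
      = infsum (\<lambda>x. infsum (\<lambda>y. ?t (glue A x y)) (B \<rightarrow>\<^sub>E UNIV)) (A \<rightarrow>\<^sub>E UNIV)"
    using assms by (intro infsum_PiE_Un le_imp_power_dvd) auto
  also have "\<dots> = infsum (\<lambda>x. fps_X ^ (\<Sum>v\<in>A. x v) * (\<Prod>u\<in>B. 1 / (1 - fps_X ^ Suc (\<Sum>v\<in>E `` {u}. x v))))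
           (A \<rightarrow>\<^sub>E UNIV)"
  proof (rule infsum_cong)
    fix x :: "'a \<Rightarrow> nat"
    let ?d = "\<lambda>u. Suc (\<Sum>v\<in>E `` {u}. x v)"
    have "?t (glue A x y) = fps_X ^ (\<Sum>v\<in>A. x v) * (\<Prod>u\<in>B. fps_X ^ (y u * ?d u))" for y
    proof -
      have "(\<Sum>(u, v)\<in>E. glue A x y u * glue A x y v) = (\<Sum>(u, v)\<in>E. y u * x v)"
      proof (intro sum.cong refl)
        fix p assume "p \<in> E"
        then have "p \<in> B \<times> A"
          using assms(4) by blast
        then have "fst p \<notin> A" "snd p \<in> A"
          using assms(3) by auto
        then show "(case p of (u, v) \<Rightarrow> glue A x y u * glue A x y v) = (case p of (u, v) \<Rightarrow> y u * x v)"
          by (simp add: case_prod_unfold)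
      qed
      also have "\<dots> = (\<Sum>u\<in>B. \<Sum>v\<in>E `` {u}. y u * x v)"
        by (subst E_eq, subst sum.Sigma) (use assms fin in auto)
      finally have "(\<Sum>(u, v)\<in>E. glue A x y u * glue A x y v) = (\<Sum>u\<in>B. y u * (\<Sum>v\<in>E `` {u}. x v))"
        by (simp add: sum_distrib_left)
      moreover have "(\<Sum>v\<in>A \<union> B. glue A x y v) = (\<Sum>v\<in>A. x v) + (\<Sum>v\<in>B. y v)"
        using assms by (subst sum.union_disjoint) (auto simp: glue_def intro!: sum.cong arg_cong2[of _ _ _ _ "(+)"])
      ultimately show ?thesis
        by (simp add: power_sum power_add sum.distrib prod.distrib mult_ac)
    qed
    moreover have "infsum (\<lambda>y. fps_X ^ (\<Sum>v\<in>A. x v) * (\<Prod>u\<in>B. fps_X ^ (y u * ?d u) :: rat fps)) (B \<rightarrow>\<^sub>E UNIV)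
        = fps_X ^ (\<Sum>v\<in>A. x v) * infsum (\<lambda>y. \<Prod>u\<in>B. fps_X ^ (y u * ?d u)) (B \<rightarrow>\<^sub>E UNIV)"
    proof (intro infsum_cmult_right summable_on_fps_PiE)
      show "fps_X ^ (\<Sum>v\<in>B. y v) dvd (\<Prod>u\<in>B. fps_X ^ (y u * ?d u) :: rat fps)" for y
        unfolding power_sum by (intro prod_dvd_prod le_imp_power_dvd) simp
    qed (use assms in auto)
    moreover have "infsum (\<lambda>y. \<Prod>u\<in>B. fps_X ^ (y u * ?d u) :: rat fps) (B \<rightarrow>\<^sub>E UNIV)
        = (\<Prod>u\<in>B. infsum (\<lambda>m. fps_X ^ (m * ?d u)) UNIV)"
      using assms(2) by (intro infsum_prod_PiE_fps le_imp_power_dvd) simp_all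
    moreover have "infsum (\<lambda>m. fps_X ^ (m * ?d u) :: rat fps) UNIV = 1 / (1 - fps_X ^ ?d u)" for u
      by (rule infsum_geometric_fps) simp
    ultimately show "infsum (\<lambda>y. ?t (glue A x y)) (B \<rightarrow>\<^sub>E UNIV)
        = fps_X ^ (\<Sum>v\<in>A. x v) * (\<Prod>u\<in>B. 1 / (1 - fps_X ^ ?d u))"
      by presburger
  qed
  finally show ?thesis .
qed

text \<open>Pulling exponent vectors back along \<open>f\<close> is a bijection of the index sets,
  from \<open>H\<close> to \<open>G\<close>, that preserves every term.\<close>

lemma graph_series_iso:
  assumes "bij_betw f (pverts G) (pverts H)"
    and "\<And>u v. u \<in> pverts G \<Longrightarrow> v \<in> pverts G \<Longrightarrow> (u, v) \<in> parcs G \<longleftrightarrow> (f u, f v) \<in> parcs H"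
  shows "graph_series G = graph_series H"
proof -
  define h where "h n = (\<lambda>u\<in>pverts G. n (f u))" for n :: "'b \<Rightarrow> nat"
  have bij: "bij_betw h (pverts H \<rightarrow>\<^sub>E UNIV) (pverts G \<rightarrow>\<^sub>E UNIV)"
  proof (rule bij_betwI[where g = "\<lambda>m. \<lambda>v\<in>pverts H. m (inv_into (pverts G) f v)"])
    show "h \<in> (pverts H \<rightarrow>\<^sub>E UNIV) \<rightarrow> (pverts G \<rightarrow>\<^sub>E UNIV)"
      by (auto simp: h_def)
    show "(\<lambda>v\<in>pverts H. h n (inv_into (pverts G) f v)) = n" if "n \<in> pverts H \<rightarrow>\<^sub>E UNIV" for n
      using that bij_betw_inv_into_right[OF assms(1)] bij_betw_inv_into[OF assms(1)]
      by (auto simp: h_def fun_eq_iff PiE_iff extensional_def bij_betw_def)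
    show "h (\<lambda>v\<in>pverts H. m (inv_into (pverts G) f v)) = m" if "m \<in> pverts G \<rightarrow>\<^sub>E UNIV" for m
      using that bij_betw_inv_into_left[OF assms(1)] bij_betwE[OF assms(1)]
      by (auto simp: h_def fun_eq_iff PiE_iff extensional_def)
  qed auto
  have "graph_term H = (\<lambda>n. graph_term G (h n))"
  proof
    fix n
    have "(\<Sum>u\<in>pverts H. \<Sum>v\<in>pverts H. n u * adjacency H u v * n v)
        = (\<Sum>u\<in>pverts G. \<Sum>v\<in>pverts G. n (f u) * adjacency H (f u) (f v) * n (f v))"
      by (simp add: sum.reindex_bij_betw[OF assms(1), symmetric])
    also have "\<dots> = (\<Sum>u\<in>pverts G. \<Sum>v\<in>pverts G. h n u * adjacency G u v * h n v)"
      by (intro sum.cong refl) (simp add: h_def adjacency_def assms(2))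
    finally show "graph_term H n = graph_term G (h n)"
      by (simp add: graph_term_def h_def sum.reindex_bij_betw[OF assms(1), symmetric]
          prod.reindex_bij_betw[OF assms(1), symmetric])
  qed
  then show ?thesis
    unfolding graph_series_def using infsum_reindex_bij_betw[OF bij, of "graph_term G"] by simp
qed

section \<open>Laurent quotients, and sequences of partial sums\<close>

text \<open>The factor \<open>1/q\<close> exists only among Laurent series; the combinatorial
  identity is proved free of division and transferred here.\<close>

lemma fls_quotient_eqI:
  fixes G Z Q :: "'a::field fps"
  assumes "fps_X * G * Q ^ N = Z" "Q \<noteq> 0"
  shows "fps_to_fls G = fls_X_inv * fps_to_fls Z / fps_to_fls Q ^ N"
proof -
  have "fps_to_fls Z = fls_X * (fps_to_fls G * fps_to_fls Q ^ N)"
    unfolding assms(1)[symmetric] by (simp add: fls_times_fps_to_fls fps_to_fls_power mult.assoc)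
  moreover have "fls_X_inv * fls_X = (1 :: 'a fls)"
    by (simp add: fls_X_inv_times_conv_shift)
  ultimately have "fls_X_inv * fps_to_fls Z = fps_to_fls G * fps_to_fls Q ^ N"
    by (simp add: mult.assoc[symmetric])
  then show ?thesis
    using assms(2) by (simp add: fps_to_fls_eq_0_iff)
qed

text \<open>The inverse takes successive differences. The reversal \<open>k + 1 - i\<close> turns
  growing partial sums into a weakly decreasing sequence, and \<open>Suc\<close> makes its entries
  positive.\<close>

lemma bij_betw_partial_sums:
  assumes "k \<ge> 1"
  shows "bij_betw (\<lambda>x. \<lambda>i\<in>{1..k}. Suc (\<Sum>j = 1..k + 1 - i. x (Vertex j)))
     (Vertex ` {1..k} \<rightarrow>\<^sub>E UNIV)
     {n \<in> {1..k} \<rightarrow>\<^sub>E UNIV. (\<forall>i\<in>{1..<k}. n i \<ge> n (Suc i)) \<and> n k \<ge> 1}"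
proof -
  define h :: "(z_vertex \<Rightarrow> nat) \<Rightarrow> nat \<Rightarrow> nat"
    where "h x = (\<lambda>i\<in>{1..k}. Suc (\<Sum>j = 1..k + 1 - i. x (Vertex j)))" for x
  \<comment> \<open>Differences read from the end of the sequence: the first is
    \<open>n k - 1\<close>, undoing the \<open>Suc\<close>; the later ones compare adjacent
    entries.\<close>
  define d :: "(nat \<Rightarrow> nat) \<Rightarrow> nat \<Rightarrow> nat"
    where "d n j = n (k + 1 - j) - (if j = 1 then 1 else n (k + 2 - j))" for n j
  define g :: "(nat \<Rightarrow> nat) \<Rightarrow> z_vertex \<Rightarrow> nat"
    where "g n = (\<lambda>v\<in>Vertex ` {1..k}. d n (inv Vertex v))" for n
  define D where "D = {n \<in> {1..k} \<rightarrow>\<^sub>E UNIV. (\<forall>i\<in>{1..<k}. n i \<ge> n (Suc i)) \<and> n k \<ge> (1::nat)}"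
  have inj: "inj Vertex"
    by (auto simp: inj_def)
  have g_Vertex: "g n (Vertex j) = d n j" if "j \<in> {1..k}" for n j
    using that by (simp add: g_def inv_f_f[OF inj])
  have h_in: "h x \<in> D" for x
    using assms by (auto simp: h_def D_def intro!: sum_mono2)
  \<comment> \<open>Subtraction in \<open>nat\<close> is exact here because \<open>n\<close> is
    weakly decreasing with \<open>n k \<ge> 1\<close>.\<close>
  have telescope: "Suc (\<Sum>j = 1..m. d n j) = n (k + 1 - m)" if "n \<in> D" "1 \<le> m" "m \<le> k" for n m
    using that(2,3)
  proof (induction m rule: dec_induct)
    case base
    then show ?case using \<open>n \<in> D\<close> by (simp add: d_def D_def)
  next
    case (step m)
    then have "n (Suc (k - m)) \<le> n (k - m)"
      using \<open>n \<in> D\<close> by (auto simp: D_def)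
    moreover have "d n (Suc m) = n (k - m) - n (Suc (k - m))"
      using step by (simp add: d_def Suc_diff_le)
    moreover have "Suc (\<Sum>j = 1..m. d n j) = n (Suc (k - m))"
      using step by (simp add: Suc_diff_le)
    moreover have "k + 1 - Suc m = k - m" "(\<Sum>j = 1..Suc m. d n j) = (\<Sum>j = 1..m. d n j) + d n (Suc m)"
      by simp_all
    ultimately show ?case
      by presburger
  qed
  have "bij_betw h (Vertex ` {1..k} \<rightarrow>\<^sub>E UNIV) D"
  proof (rule bij_betwI[where g = g])
    show "h \<in> (Vertex ` {1..k} \<rightarrow>\<^sub>E UNIV) \<rightarrow> D"
      using h_in by auto
    show "g \<in> D \<rightarrow> (Vertex ` {1..k} \<rightarrow>\<^sub>E UNIV)"
      by (auto simp: g_def)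
    show "g (h x) = x" if x: "x \<in> Vertex ` {1..k} \<rightarrow>\<^sub>E UNIV" for x
    proof
      fix v
      show "g (h x) v = x v"
      proof (cases "v \<in> Vertex ` {1..k}")
        case True
        then obtain j where j: "v = Vertex j" "j \<in> {1..k}"
          by auto
        have h: "h x (k + 1 - i) = Suc (\<Sum>j = 1..i. x (Vertex j))" if "i \<in> {1..k}" for i
          using that by (auto simp: h_def)
        have "d (h x) j = x (Vertex j)"
        proof (cases "j = 1")
          case False
          then obtain i where i: "j = Suc i" "i \<in> {1..k}"
            using j by (cases j) auto
          have "d (h x) j = h x (k + 1 - j) - h x (k + 1 - i)"
            using i by (simp add: d_def)
          also have "\<dots> = x (Vertex j)"
            unfolding h[OF j(2)] h[OF i(2)] by (simp add: i)
          finally show ?thesis .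
        qed (use h[OF j(2)] in \<open>simp add: d_def\<close>)
        then show ?thesis
          using j by (simp add: g_Vertex)
      next
        case False
        then show ?thesis
          using x by (auto simp: g_def PiE_iff extensional_def)
      qed
    qed
    show "h (g n) = n" if n: "n \<in> D" for n
    proof
      fix i
      show "h (g n) i = n i"
      proof (cases "i \<in> {1..k}")
        case True
        then have "(\<Sum>j = 1..k + 1 - i. g n (Vertex j)) = (\<Sum>j = 1..k + 1 - i. d n j)"
          by (intro sum.cong g_Vertex) auto
        moreover have "Suc (\<Sum>j = 1..k + 1 - i. d n j) = n (k + 1 - (k + 1 - i))"
          by (rule telescope[OF n]) (use True in auto)
        ultimately show ?thesis
          using True by (simp add: h_def)
      next
        case False
        then show ?thesis
          using n by (auto simp: h_def D_def PiE_iff extensional_def)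
      qed
    qed
  qed
  then show ?thesis
    by (simp add: h_def[abs_def] D_def)
qed

section \<open>The star-shaped tree as the case \<open>k = 1\<close>\<close>

text \<open>For \<open>k = 1\<close> an isomorphism: \<open>Vertex 1\<close> becomes the centre, leg
  \<open>c\<close> runs through \<open>2 * c\<close> to \<open>2 * c + 1\<close>, and
  \<open>Primed 1\<close> becomes the leaf next to the centre.\<close>

fun z_to_t :: "nat \<Rightarrow> z_vertex \<Rightarrow> nat" where
  "z_to_t r (Vertex i) = 1"
| "z_to_t r (Primed i) = 2 * r + 2"
| "z_to_t r (U i c) = 2 * c"
| "z_to_t r (W i c) = 2 * c + 1"

lemma graph_series_T_graph: "graph_series (T_graph r) = graph_series (Z_graph 1 (\<lambda>_. r))"
proof (rule graph_series_iso[symmetric])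
  let ?Z = "Z_graph 1 (\<lambda>_. r)"
  have verts: "pverts ?Z = {Vertex 1, Primed 1} \<union> U 1 ` {1..r} \<union> W 1 ` {1..r}"
    by (auto simp: Z_graph_def Z_verts_def undirected_def)
  have inj: "inj_on (z_to_t r) (pverts ?Z)"
    unfolding verts by (auto simp: inj_on_def) presburger+
  have "z_to_t r ` pverts ?Z = {1..2 * r + 2}"
  proof
    show "{1..2 * r + 2} \<subseteq> z_to_t r ` pverts ?Z"
    proof
      fix m assume m: "m \<in> {1..2 * r + 2}"
      consider "m = 1" | "m = 2 * r + 2" | c where "m = 2 * c" "c \<in> {1..r}"
        | c where "m = 2 * c + 1" "c \<in> {1..r}"
      proof (cases "even m")
        case True
        then obtain c where "m = 2 * c" by (elim evenE)
        then show ?thesis using m that(2,3) by (cases "c = r + 1") auto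
      next
        case False
        then obtain c where "m = 2 * c + 1" by (elim oddE)
        then show ?thesis using m that(1,4) by (cases "c = 0") auto
      qed
      then show "m \<in> z_to_t r ` pverts ?Z"
      proof cases
        case (3 c)
        then show ?thesis
          unfolding verts by (intro image_eqI[of _ _ "U 1 c"]) auto
      next
        case (4 c)
        then show ?thesis
          unfolding verts by (intro image_eqI[of _ _ "W 1 c"]) auto
      qed (simp_all add: verts del: One_nat_def)
    qed
  qed (auto simp: verts simp del: One_nat_def)
  with inj show "bij_betw (z_to_t r) (pverts ?Z) (pverts (T_graph r))"
    by (simp add: bij_betw_def T_graph_def undirected_def)
  \<comment> \<open>In this form, a case split on the constructors of \<open>u\<close> and
    \<open>v\<close> reduces the comparison of arcs to linear and parity arithmetic.\<close>
  have Z_arcs: "parcs ?Z = (let E = {(Vertex 1, Primed 1)} \<union> (\<lambda>c. (U 1 c, W 1 c)) ` {1..r}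
      \<union> (\<lambda>c. (U 1 c, Vertex 1)) ` {1..r} in E \<union> E\<inverse>)"
    by (auto simp: Z_graph_def Z_edges_def undirected_def Let_def image_iff)
  have T_arcs: "(u, v) \<in> parcs (T_graph r) \<longleftrightarrow> (\<exists>j\<in>{1..r}.
        u = 1 \<and> v = 2 * j \<or> v = 1 \<and> u = 2 * j \<or> u = 2 * j \<and> v = 2 * j + 1 \<or> v = 2 * j \<and> u = 2 * j + 1)
      \<or> u = 1 \<and> v = 2 * r + 2 \<or> v = 1 \<and> u = 2 * r + 2" for u v
    unfolding T_graph_def undirected_def by auto
  fix u v
  assume "u \<in> pverts ?Z" "v \<in> pverts ?Z"
  then show "(u, v) \<in> parcs ?Z \<longleftrightarrow> (z_to_t r u, z_to_t r v) \<in> parcs (T_graph r)"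
    unfolding verts Z_arcs T_arcs Let_def
    by (elim UnE insertE emptyE imageE; simp add: image_iff; presburger?)
qed

section \<open>The identity for the graphs \<open>Z_graph k a\<close>\<close>

fun z_leaf :: "z_vertex \<Rightarrow> z_vertex" where
  "z_leaf (Vertex i) = Primed i"
| "z_leaf (U i c) = W i c"
| "z_leaf v = v"

text \<open>The graph is a corona over \<open>A \<union> B\<close>, whose core edges join
  \<open>B\<close> to \<open>A\<close>. Corona and bipartite summation leave a sum over the
  exponents on \<open>A\<close>, which the partial sums reindex to the zeta value.\<close>

lemma graph_series_Z_graph:
  assumes "k \<ge> 1"
  shows "fps_X * graph_series (Z_graph k a) * q_inf ^ (k + (\<Sum>i = 1..k. a i)) = qzeta_star k a"
proof -
  define A where "A = Vertex ` {1..k}"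
  define I where "I = Sigma {1..k} (\<lambda>i. {1..a i})"
  define B where "B = (\<lambda>(i, c). U i c) ` I"
  define E where "E = {(U i c, Vertex j) |i c j. i \<in> {1..k} \<and> c \<in> {1..a i} \<and> j \<in> {1..k + 1 - i}}"
  define t where "t x = fps_X ^ (\<Sum>v\<in>A. x v) * (\<Prod>u\<in>B. 1 / (1 - fps_X ^ Suc (\<Sum>v\<in>E `` {u}. x v)) :: rat fps)"
    for x :: "z_vertex \<Rightarrow> nat"
  define h :: "(z_vertex \<Rightarrow> nat) \<Rightarrow> nat \<Rightarrow> nat"
    where "h x = (\<lambda>i\<in>{1..k}. Suc (\<Sum>j = 1..k + 1 - i. x (Vertex j)))" for x
  have fin: "finite A" "finite B"
    by (simp_all add: A_def B_def I_def)
  have disj: "A \<inter> B = {}"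
    by (auto simp: A_def B_def)
  have E: "E \<subseteq> B \<times> A"
    by (auto simp: E_def B_def A_def I_def image_iff)
  have inj_U: "inj_on (\<lambda>(i, c). U i c) I"
    by (auto simp: inj_on_def)
  have "card A = k"
    by (simp add: A_def card_image inj_on_def)
  moreover have "card B = (\<Sum>i = 1..k. a i)"
    unfolding B_def card_image[OF inj_U] by (simp add: I_def)
  ultimately have card: "card (A \<union> B) = k + (\<Sum>i = 1..k. a i)"
    using fin disj by (simp add: card_Un_disjoint)
  have B_eq: "B = {U i c |i c. i \<in> {1..k} \<and> c \<in> {1..a i}}"
    by (auto simp: B_def I_def)
  have leaves: "z_leaf ` A = Primed ` {1..k}" "z_leaf ` B = {W i c |i c. i \<in> {1..k} \<and> c \<in> {1..a i}}"
    by (auto simp: A_def B_def I_def image_iff)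
  have verts: "Z_verts k a = (A \<union> B) \<union> z_leaf ` (A \<union> B)"
    unfolding image_Un leaves unfolding Z_verts_def A_def B_eq by blast
  have edge_A: "(\<lambda>v. (v, z_leaf v)) ` A = {(Vertex i, Primed i) |i. i \<in> {1..k}}"
    by (auto simp: A_def)
  have edge_B: "(\<lambda>v. (v, z_leaf v)) ` B = {(U i c, W i c) |i c. i \<in> {1..k} \<and> c \<in> {1..a i}}"
    by (auto simp: B_def I_def image_iff)
  have edges: "Z_edges k a = E \<union> (\<lambda>v. (v, z_leaf v)) ` (A \<union> B)"
    unfolding image_Un edge_A edge_B by (auto simp: Z_edges_def E_def)
  have "graph_series (Z_graph k a) * q_inf ^ card (A \<union> B)
      = infsum (\<lambda>n. fps_X ^ ((\<Sum>(u, v)\<in>E. n u * n v) + (\<Sum>v\<in>A \<union> B. n v))) (A \<union> B \<rightarrow>\<^sub>E UNIV)"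
    unfolding Z_graph_def verts edges
  proof (rule graph_series_corona)
    show "inj_on z_leaf (A \<union> B)" "(A \<union> B) \<inter> z_leaf ` (A \<union> B) = {}"
      by (auto simp: A_def B_def inj_on_def)
    show "(v, u) \<notin> E" if "(u, v) \<in> E" for u v
      using that E disj by blast
  qed (use fin E in auto)
  also have "\<dots> = infsum t (A \<rightarrow>\<^sub>E UNIV)"
    unfolding t_def by (rule infsum_bipartite[OF fin disj E])
  finally have "fps_X * graph_series (Z_graph k a) * q_inf ^ card (A \<union> B) = fps_X * infsum t (A \<rightarrow>\<^sub>E UNIV)"
    by (simp add: mult.assoc)
  also have "\<dots> = infsum (\<lambda>x. fps_X * t x) (A \<rightarrow>\<^sub>E UNIV)"
    by (rule infsum_cmult_right[symmetric], rule summable_on_fps_PiE) (simp_all add: fin t_def)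
  also have "\<dots> = infsum (\<lambda>x. fps_X ^ h x 1 / (\<Prod>i = 1..k. (1 - fps_X ^ h x i) ^ a i)) (A \<rightarrow>\<^sub>E UNIV)"
  proof (rule infsum_cong)
    fix x :: "z_vertex \<Rightarrow> nat"
    have "(\<Sum>v\<in>A. x v) = (\<Sum>j = 1..k. x (Vertex j))"
      by (simp add: A_def sum.reindex inj_on_def)
    \<comment> \<open>The source of the factor \<open>1/q\<close>: the largest entry is
      \<open>h x 1\<close>, one more than the total over \<open>A\<close>.\<close>
    then have X: "fps_X * fps_X ^ (\<Sum>v\<in>A. x v) = (fps_X ^ h x 1 :: rat fps)"
      using assms by (simp add: h_def)
    have nbr: "E `` {U i c} = Vertex ` {1..k + 1 - i}" if "(i, c) \<in> I" for i c
      using that by (auto simp: E_def I_def)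
    have h: "Suc (\<Sum>v\<in>E `` {U i c}. x v) = h x i" if "(i, c) \<in> I" for i c
      unfolding nbr[OF that] using that by (simp add: h_def sum.reindex inj_on_def I_def)
    have "(\<Prod>u\<in>B. 1 / (1 - fps_X ^ Suc (\<Sum>v\<in>E `` {u}. x v)) :: rat fps)
        = (\<Prod>(i, c)\<in>I. 1 / (1 - fps_X ^ h x i))"
      unfolding B_def prod.reindex[OF inj_U]
      by (rule prod.cong) (auto simp del: power_Suc simp: h)
    \<comment> \<open>The \<open>a i\<close> vertices \<open>U i c\<close> share one neighbourhood,
      hence one factor, which produces the power \<open>a i\<close>.\<close>
    also have "\<dots> = (\<Prod>i = 1..k. \<Prod>c = 1..a i. 1 / (1 - fps_X ^ h x i))"
      unfolding I_def by (subst prod.Sigma) auto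
    also have "\<dots> = (\<Prod>i = 1..k. inverse ((1 - fps_X ^ h x i) ^ a i))"
    proof (rule prod.cong)
      fix i assume "i \<in> {1..k}"
      \<comment> \<open>Since \<open>h x i\<close> is a successor, the constant coefficient is 1 and
        division is inversion of a unit.\<close>
      then have "fps_nth (1 - fps_X ^ h x i :: rat fps) 0 \<noteq> 0"
        by (simp add: h_def)
      then show "(\<Prod>c = 1..a i. 1 / (1 - fps_X ^ h x i)) = inverse ((1 - fps_X ^ h x i :: rat fps) ^ a i)"
        by (simp add: fps_divide_unit fps_inverse_power)
    qed simp
    also have "\<dots> = inverse (\<Prod>i = 1..k. (1 - fps_X ^ h x i) ^ a i)"
      by (simp add: fps_inverse_prod)
    finally have "fps_X * t x = fps_X ^ h x 1 * inverse (\<Prod>i = 1..k. (1 - fps_X ^ h x i) ^ a i)"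
      by (simp only: t_def X[symmetric] mult.assoc)
    moreover have "fps_nth (\<Prod>i = 1..k. (1 - fps_X ^ h x i :: rat fps) ^ a i) 0 \<noteq> 0"
      by (simp add: fps_nth_prod_0 fps_nth_power_0 h_def)
    ultimately show "fps_X * t x = fps_X ^ h x 1 / (\<Prod>i = 1..k. (1 - fps_X ^ h x i) ^ a i)"
      by (simp add: fps_divide_unit)
  qed
  also have "\<dots> = qzeta_star k a"
    unfolding qzeta_star_def A_def h_def
    using infsum_reindex_bij_betw[OF bij_betw_partial_sums[OF assms]] .
  finally show ?thesis
    by (simp only: card)
qed

theorem theorem1p3:
  shows "(\<forall>(k::nat) (a::nat \<Rightarrow> nat). k \<ge> 1 \<and> (\<forall>i\<in>{1..k}. a i \<ge> 1) \<longrightarrow>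
            pair_graph (Z_graph k a) \<and>
            fps_to_fls (graph_series (Z_graph k a)) =
              fls_X_inv * fps_to_fls (qzeta_star k a)
              / fps_to_fls q_inf ^ (k + (\<Sum>i = 1..k. a i)))
       \<and> (\<forall>r::nat. r \<ge> 1 \<longrightarrow>
            pair_graph (T_graph r) \<and>
            fps_to_fls (graph_series (T_graph r)) =
              fls_X_inv * fps_to_fls (qzeta_star 1 (\<lambda>_. r)) / fps_to_fls q_inf ^ (r + 1))"
proof -
  have "infsum (euler_term 0) UNIV * q_inf = 1"
    using infsum_euler_term[of 0] by simp
  then have q_inf: "q_inf \<noteq> 0"
    by auto
  have Z: "fps_to_fls (graph_series (Z_graph k a)) =
      fls_X_inv * fps_to_fls (qzeta_star k a) / fps_to_fls q_inf ^ (k + (\<Sum>i = 1..k. a i))"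
    if "k \<ge> 1" for k a
    by (rule fls_quotient_eqI[OF graph_series_Z_graph[OF that] q_inf])
  have "fps_to_fls (graph_series (T_graph r)) =
      fls_X_inv * fps_to_fls (qzeta_star 1 (\<lambda>_. r)) / fps_to_fls q_inf ^ (r + 1)" for r
    \<comment> \<open>For \<open>k = 1\<close> the exponent \<open>k + (\<Sum>i = 1..k. a i)\<close>
      is \<open>1 + r\<close>.\<close>
    using Z[of 1 "\<lambda>_. r"] unfolding graph_series_T_graph by (simp add: add.commute)
  with Z pair_graph_Z pair_graph_T show ?thesis
    by blast
qed

end
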